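(* Let $m$ be a $\sigma$-finite measure on a measurable space $(E,\mathcal{E})$ and let $f_s:E\to\mathbb{R}$, $s\in\mathbb{R}^d$, be functions with $f_s\in\mathcal{L}^1(m)$ for all $s\in\mathbb{R}^d$. Suppose that for all compact sets $K\subset\mathbb{R}^d$ $$\int_E\sup_{t\in K\cap\mathbb{Q}_*^d}|f_t(z)|\,m(dz)<\infty$$ and $$\int_E\sup_{t\in K\cap\mathbb{Q}_*^d}|f_{t+c}(z)|\,m(dz)=\int_E\sup_{t\in K\cap\mathbb{Q}_*^d}|f_t(z)|\,m(dz)\qquad\text{for all } c\in\mathbb{Q}_*^d .$$ Then, for $\delta=0$ and for every $\delta=1/n$, $n\in\mathbb{N}$, the constant $$H_{|f|,m}^\delta=\lim_{T\to\infty}\frac1{T^d}\int_E\sup_{t\in[0,T]^d\cap\delta\mathbb{Z}^d}|f_t(z)|\,m(dz)$$ is well-defined (the limit exists), finite and non-negative, and further $$\lim_{n\to\infty}H_{|f|,m}^{2^{-n}}=H_{|f|,m}^0 .$$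
   Context: $\mathbb{Q}_*=\{k/2^n:k\in\mathbb{Z},n\in\mathbb{N}\}$ is the set of dyadic rational numbers. In this statement the convention is $0\mathbb{Z}^d:=\mathbb{Q}_*^d$, so $H^0_{|f|,m}$ uses the supremum over $[0,T]^d\cap\mathbb{Q}_*^d$. $\mathcal{L}^1(m)$ is the set of functions $g$ on $E$ with $\int_E|g(x)|\,m(dx)<\infty$.
   Formalization: For n not a power of two the claim fails as stated (f_t = 0 at dyadic t, f_t = t² elsewhere, d = 1, δ = 1/3); for such n the finiteness and shift-invariance conditions are also required with (1/n)Z^d in place of the dyadic points, including for the shifts c. *)

theory Defs
  imports "HOL-Analysis.Analysis"
begin

definition dyadic_rationals :: "real set" where
  "dyadic_rationals = {real_of_int k / 2 ^ n | (k::int) (n::nat). True}"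

text \<open>The grid of mesh \<open>\<delta>\<close> in \<open>\<real>\<^sup>d\<close>, with the convention that mesh \<open>0\<close> means the
  dyadic rational points.\<close>

definition grid :: "real \<Rightarrow> (real ^ 'd) set" where
  "grid \<delta> =
     (if \<delta> = 0 then {t. \<forall>i. t $ i \<in> dyadic_rationals}
      else {t. \<forall>i. \<exists>k::int. t $ i = \<delta> * real_of_int k})"

text \<open>Integrals of suprema are taken in \<open>ennreal\<close>: the pointwise supremum may be infinite
  somewhere, and the supremum over an empty index set is \<open>0\<close>.\<close>

definition sup_integral ::
  "'a measure \<Rightarrow> (real ^ 'd \<Rightarrow> 'a \<Rightarrow> real) \<Rightarrow> (real ^ 'd) set \<Rightarrow> ennreal" where
  "sup_integral m f A = (\<integral>\<^sup>+ z. (SUP t\<in>A. ennreal \<bar>f t z\<bar>) \<partial>m)"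

text \<open>Used with \<open>L = grid 0\<close> for the standing hypothesis. That hypothesis says nothing about
  \<open>f t\<close> at non-dyadic points \<open>t\<close>, which make up most of \<open>grid (1 / n)\<close> when \<open>n\<close> is not a
  power of two, and the limit over such a grid may then be infinite (\<open>f t = 0\<close> at dyadic \<open>t\<close>,
  \<open>f t = t\<^sup>2\<close> elsewhere). For these meshes the condition is required with
  \<open>L = grid (1 / n)\<close> as well.\<close>

definition sup_shift_invariant ::
  "'a measure \<Rightarrow> (real ^ 'd \<Rightarrow> 'a \<Rightarrow> real) \<Rightarrow> (real ^ 'd) set \<Rightarrow> bool" where
  "sup_shift_invariant m f L \<longleftrightarrow>
     (\<forall>K. compact K \<longrightarrow>
        sup_integral m f (K \<inter> L) < \<infinity> \<and>
        (\<forall>c\<in>L. sup_integral m (\<lambda>t. f (t + c)) (K \<inter> L) = sup_integral m f (K \<inter> L)))"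

definition H_ratio ::
  "'a measure \<Rightarrow> (real ^ 'd \<Rightarrow> 'a \<Rightarrow> real) \<Rightarrow> real \<Rightarrow> real \<Rightarrow> ennreal" where
  "H_ratio m f \<delta> T =
     sup_integral m f (cbox 0 (\<chi> i. T) \<inter> grid \<delta>) / ennreal (T ^ CARD('d))"

text \<open>\<open>Lim\<close> is an unspecified value if the limit does not exist, so existence of the limit
  has to be asserted separately.\<close>

definition H_const ::
  "'a measure \<Rightarrow> (real ^ 'd \<Rightarrow> 'a \<Rightarrow> real) \<Rightarrow> real \<Rightarrow> ennreal" where
  "H_const m f \<delta> = Lim at_top (H_ratio m f \<delta>)"

text \<open>Whether \<open>H_const m f \<delta>\<close> is well-defined, finite and non-negative.\<close>

definition H_well_defined ::
  "'a measure \<Rightarrow> (real ^ 'd \<Rightarrow> 'a \<Rightarrow> real) \<Rightarrow> real \<Rightarrow> bool" where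
  "H_well_defined m f \<delta> \<longleftrightarrow>
     (H_ratio m f \<delta> \<longlongrightarrow> H_const m f \<delta>) at_top \<and>
     0 \<le> H_const m f \<delta> \<and> H_const m f \<delta> < \<infinity>"

end

theory Submission
  imports Defs
begin

text \<open>Cover \<open>[0,T]\<^sup>d\<close> by \<open>N\<^sup>d\<close> integer translates of \<open>[0,p]\<^sup>d\<close>, where \<open>p\<close> is a positive integer and
  \<open>T \<le> N p\<close>. Shift invariance bounds the integral \<open>g(T)\<close> of the supremum over \<open>[0,T]\<^sup>d\<close> by
  \<open>N\<^sup>d g(p)\<close>, so \<open>g(T) / T\<^sup>d\<close> converges to the infimum of \<open>g(p) / p\<^sup>d\<close>. For the limit in the
  mesh, let \<open>M\<^sub>j\<close> and \<open>M'\<^sub>j\<close> be the suprema over the fine and the coarse grid points of the \<open>j\<close>-th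
  unit cube. Then \<open>max\<^sub>j M\<^sub>j + \<Sum>\<^sub>j M'\<^sub>j \<le> max\<^sub>j M'\<^sub>j + \<Sum>\<^sub>j M\<^sub>j\<close>; integrating over \<open>N\<^sup>d\<close> cubes shows
  that the two constants differ by at most the difference of the integrals for a single unit cube,
  which tends to \<open>0\<close> by monotone convergence.\<close>

section \<open>Grids\<close>

lemma dyadic_rationals_diff:
  assumes "x \<in> dyadic_rationals" "y \<in> dyadic_rationals"
  shows "x - y \<in> dyadic_rationals"
proof -
  obtain k n l n' where "x = real_of_int k / 2 ^ n" "y = real_of_int l / 2 ^ n'"
    using assms unfolding dyadic_rationals_def by blast
  then have "x - y = real_of_int (k * 2 ^ n' - l * 2 ^ n) / 2 ^ (n + n')"
    by (simp add: diff_divide_distrib power_add)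
  then show ?thesis
    unfolding dyadic_rationals_def by blast
qed

lemma dyadic_rationals_mult_int:
  assumes "x \<in> dyadic_rationals"
  shows "x * real_of_int l \<in> dyadic_rationals"
proof -
  obtain k n where "x = real_of_int k / 2 ^ n"
    using assms unfolding dyadic_rationals_def by blast
  then have "x * real_of_int l = real_of_int (k * l) / 2 ^ n"
    by simp
  then show ?thesis
    unfolding dyadic_rationals_def by blast
qed

lemma countable_dyadic_rationals: "countable dyadic_rationals"
proof -
  have "dyadic_rationals = (\<lambda>(k, n). real_of_int k / 2 ^ n) ` (UNIV :: (int \<times> nat) set)"
    by (auto simp: dyadic_rationals_def)
  then show ?thesis by (metis countable_image countableI_type)
qed

lemma countable_vectors:
  assumes "countable S"
  shows "countable {t :: 'a ^ 'd. \<forall>i. t $ i \<in> S}"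
proof (rule countable_image_inj_on)
  show "inj_on vec_nth {t :: 'a ^ 'd. \<forall>i. t $ i \<in> S}"
    by (auto simp: inj_on_def vec_nth_inject)
  have "vec_nth ` {t :: 'a ^ 'd. \<forall>i. t $ i \<in> S} \<subseteq> (\<Pi>\<^sub>E i\<in>UNIV. S)"
    by auto
  then show "countable (vec_nth ` {t :: 'a ^ 'd. \<forall>i. t $ i \<in> S})"
    by (rule countable_subset) (use assms in \<open>auto intro: countable_PiE\<close>)
qed

lemma countable_grid: "countable (grid \<delta> :: (real ^ 'd) set)"
proof (cases "\<delta> = 0")
  case True
  then show ?thesis
    using countable_vectors[OF countable_dyadic_rationals] by (simp add: grid_def)
next
  case False
  have "countable (range (\<lambda>k::int. \<delta> * real_of_int k))" by simp
  from countable_vectors[OF this] show ?thesis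
    using False by (simp add: grid_def image_iff)
qed

lemma grid_diff:
  assumes "s \<in> grid \<delta>" "t \<in> grid \<delta>"
  shows "s - t \<in> grid \<delta>"
proof (cases "\<delta> = 0")
  case True
  then show ?thesis using assms by (simp add: grid_def dyadic_rationals_diff)
next
  case False
  have "\<exists>k::int. (s - t) $ i = \<delta> * real_of_int k" for i
  proof -
    obtain k l :: int where "s $ i = \<delta> * real_of_int k" "t $ i = \<delta> * real_of_int l"
      using assms False unfolding grid_def by (simp, blast)
    then have "(s - t) $ i = \<delta> * real_of_int (k - l)" by (simp add: algebra_simps)
    then show ?thesis by blast
  qed
  then show ?thesis using False by (simp add: grid_def)
qed

lemma grid_subset_dyadic:
  assumes "\<delta> \<in> dyadic_rationals"
  shows "grid \<delta> \<subseteq> grid 0"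
proof
  fix t assume "t \<in> grid \<delta>"
  then show "t \<in> grid 0"
    using dyadic_rationals_mult_int[OF assms] unfolding grid_def
    by (auto split: if_splits) metis
qed

lemma grid_one_subset:
  assumes "n \<ge> 1"
  shows "grid 1 \<subseteq> grid (1 / real n)"
proof
  fix t assume t: "t \<in> grid 1"
  have "\<exists>k::int. t $ i = 1 / real n * real_of_int k" for i
  proof -
    obtain l :: int where "t $ i = real_of_int l"
      using t unfolding grid_def by auto
    then have "t $ i = 1 / real n * real_of_int (int n * l)" using assms by simp
    then show ?thesis by blast
  qed
  then show "t \<in> grid (1 / real n)" using assms by (simp add: grid_def)
qed

lemma inverse_power2_dyadic: "1 / 2 ^ n \<in> dyadic_rationals"
  unfolding dyadic_rationals_def by (rule CollectI, rule exI[of _ 1], rule exI[of _ n]) simp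

lemma grid_one_subset_dyadic: "grid 1 \<subseteq> grid 0"
  using grid_subset_dyadic[OF inverse_power2_dyadic[of 0]] by simp

lemma grid_inverse_power2_mono:
  assumes "a \<le> b"
  shows "grid (1 / 2 ^ a) \<subseteq> grid (1 / 2 ^ b)"
proof
  fix t :: "real ^ 'd" assume t: "t \<in> grid (1 / 2 ^ a)"
  have "\<exists>k::int. t $ i = 1 / 2 ^ b * real_of_int k" for i
  proof -
    obtain l :: int where l: "t $ i = 1 / 2 ^ a * real_of_int l"
      using t unfolding grid_def by auto
    have "t $ i = 1 / 2 ^ b * real_of_int (2 ^ (b - a) * l)"
      using power_add[of "2::real" a "b - a"] assms by (simp add: l)
    then show ?thesis by blast
  qed
  then show "t \<in> grid (1 / 2 ^ b)" by (simp add: grid_def)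
qed

lemma grid_zero_eq_Union: "grid 0 = (\<Union>n. grid (1 / 2 ^ n))"
proof
  show "(\<Union>n. grid (1 / 2 ^ n)) \<subseteq> (grid 0 :: (real ^ 'd) set)"
    using grid_subset_dyadic[OF inverse_power2_dyadic] by blast
  show "(grid 0 :: (real ^ 'd) set) \<subseteq> (\<Union>n. grid (1 / 2 ^ n))"
  proof
    fix t :: "real ^ 'd" assume "t \<in> grid 0"
    then have "\<forall>i. \<exists>n. \<exists>k::int. t $ i = real_of_int k / 2 ^ n"
      by (force simp: grid_def dyadic_rationals_def)
    then obtain e where e: "\<And>i. \<exists>k::int. t $ i = real_of_int k / 2 ^ e i" by metis
    \<comment> \<open>There are only finitely many coordinates, so the largest exponent gives a
      common denominator.\<close>
    define n where "n = Max (range e)"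
    have "\<exists>k::int. t $ i = 1 / 2 ^ n * real_of_int k" for i
    proof -
      obtain k :: int where k: "t $ i = real_of_int k / 2 ^ e i" using e by blast
      have "e i \<le> n" unfolding n_def by simp
      then have "t $ i = 1 / 2 ^ n * real_of_int (2 ^ (n - e i) * k)"
        using power_add[of "2::real" "e i" "n - e i"] by (simp add: k)
      then show ?thesis by blast
    qed
    then have "t \<in> grid (1 / 2 ^ n)" by (simp add: grid_def)
    then show "t \<in> (\<Union>n. grid (1 / 2 ^ n))" by blast
  qed
qed

text \<open>The integers are closed and the coordinate maps are continuous. Mesh \<open>0\<close> is
  excluded because the dyadic points are dense.\<close>

lemma closed_grid:
  assumes "\<delta> \<noteq> 0"
  shows "closed (grid \<delta> :: (real ^ 'd) set)"
proof -
  have "grid \<delta> = (\<Inter>i. (\<lambda>t :: real ^ 'd. t $ i / \<delta>) -` \<int>)"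
    using assms by (auto simp: grid_def Ints_def image_iff field_simps)
  moreover have "closed ((\<lambda>t :: real ^ 'd. t $ i / \<delta>) -` \<int>)" for i
    unfolding Ints_def using assms
    by (intro closed_vimage closed_of_int_image continuous_intros) auto
  ultimately show ?thesis by auto
qed

text \<open>The condition for \<open>L\<close> ranges over all compact sets, and
  \<open>K \<inter> L'\<close> is itself compact when \<open>L'\<close> is closed. In this way the
  hypothesis on dyadic points passes to every nonzero dyadic mesh.\<close>

lemma sup_shift_invariant_subset:
  fixes f :: "real ^ 'd \<Rightarrow> 'a \<Rightarrow> real"
  assumes "sup_shift_invariant m f L" "closed L'" "L' \<subseteq> L"
  shows "sup_shift_invariant m f L'"
  unfolding sup_shift_invariant_def
proof (intro allI impI)
  fix K :: "(real ^ 'd) set" assume "compact K"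
  then have "compact (K \<inter> L')" using assms(2) by (rule compact_Int_closed)
  moreover have "K \<inter> L' \<inter> L = K \<inter> L'" using assms(3) by auto
  ultimately show "sup_integral m f (K \<inter> L') < \<infinity> \<and>
      (\<forall>c\<in>L'. sup_integral m (\<lambda>t. f (t + c)) (K \<inter> L') = sup_integral m f (K \<inter> L'))"
    using assms(1,3) unfolding sup_shift_invariant_def by (metis subsetD)
qed

section \<open>Covering boxes by translated cubes\<close>

abbreviation cube :: "real \<Rightarrow> (real ^ 'd) set" where
  "cube T \<equiv> cbox 0 (\<chi> i. T)"

definition cube_index :: "nat \<Rightarrow> ('d \<Rightarrow> nat) set" where
  "cube_index N = (\<Pi>\<^sub>E i\<in>UNIV. {..<N})"

text \<open>The lowest vertex of the \<open>k\<close>-th cube of side \<open>p\<close>. With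
  \<open>p\<close> a natural number it has integer coordinates, so it is an admissible shift for
  every grid containing \<open>grid 1\<close>.\<close>

definition corner :: "nat \<Rightarrow> ('d \<Rightarrow> nat) \<Rightarrow> real ^ 'd" where
  "corner p k = (\<chi> i. real p * real (k i))"

lemma finite_cube_index: "finite (cube_index N :: ('d::finite \<Rightarrow> nat) set)"
  by (simp add: cube_index_def finite_PiE)

lemma card_cube_index: "card (cube_index N :: ('d::finite \<Rightarrow> nat) set) = N ^ CARD('d)"
  by (simp add: cube_index_def card_PiE)

lemma cube_index_nonempty: "N > 0 \<Longrightarrow> cube_index N \<noteq> {}"
  by (auto simp: cube_index_def PiE_eq_empty_iff)

lemma corner_in_grid_one: "corner p k \<in> grid 1"
proof -
  have "corner p k $ i = 1 * real_of_int (int p * int (k i))" for i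
    by (simp add: corner_def)
  then have "\<forall>i. \<exists>l::int. corner p k $ i = 1 * real_of_int l" by blast
  then show ?thesis unfolding grid_def by simp
qed

lemma interval_cover:
  fixes x :: real
  assumes "0 \<le> x" "x \<le> real N * real p" "N > 0" "p > 0"
  shows "\<exists>k<N. real p * real k \<le> x \<and> x \<le> real p * real k + real p"
proof (cases "x = real N * real p")
  \<comment> \<open>At the right end the floor of \<open>x / p\<close> would be \<open>N\<close>,
    one past the last index, so the closed interval with index \<open>N - 1\<close> is
    taken.\<close>
  case True
  then show ?thesis using assms
    by (intro exI[of _ "N - 1"]) (auto simp: of_nat_diff algebra_simps)
next
  case False
  define k where "k = nat \<lfloor>x / real p\<rfloor>"
  have k: "real k = of_int \<lfloor>x / real p\<rfloor>" using assms by (simp add: k_def)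
  have "real k \<le> x / real p" "x / real p < real k + 1" unfolding k by linarith+
  then have "real p * real k \<le> x" "x \<le> real p * real k + real p"
    using assms by (simp_all add: field_simps)
  moreover have "k < N"
  proof -
    have "real p * real k < real p * real N"
      using \<open>real p * real k \<le> x\<close> False assms(2) by (simp add: mult.commute)
    then show ?thesis using assms by simp
  qed
  ultimately show ?thesis by blast
qed

lemma cube_subset_translates:
  assumes "T \<le> real N * real p" "N > 0" "p > 0"
  shows "cube T \<subseteq> (\<Union>k\<in>cube_index N. (\<lambda>t. t + corner p k) ` cube (real p))"
proof
  fix t :: "real ^ 'd" assume t: "t \<in> cube T"
  have "\<forall>i. \<exists>k<N. real p * real k \<le> t $ i \<and> t $ i \<le> real p * real k + real p"
    using t assms by (intro allI interval_cover) (auto simp: mem_box_cart intro: order_trans)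
  then obtain k where k: "\<And>i. k i < N" "\<And>i. real p * real (k i) \<le> t $ i"
      "\<And>i. t $ i \<le> real p * real (k i) + real p"
    by metis
  have "k \<in> cube_index N" using k by (auto simp: cube_index_def)
  moreover have "t - corner p k \<in> cube (real p)"
    using k by (auto simp: mem_box_cart corner_def algebra_simps)
  then have "t \<in> (\<lambda>t. t + corner p k) ` cube (real p)"
    by (intro image_eqI[of _ _ "t - corner p k"]) auto
  ultimately show "t \<in> (\<Union>k\<in>cube_index N. (\<lambda>t. t + corner p k) ` cube (real p))" by blast
qed

text \<open>Together with the cover above, this shows that the unit cubes fill the box exactly; it
  bounds the supremum over one unit cube by that over the box.\<close>

lemma translate_subset_cube:
  fixes k :: "'d::finite \<Rightarrow> nat"
  assumes "k \<in> cube_index N"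
  shows "(\<lambda>t. t + corner 1 k) ` cube 1 \<subseteq> cube (real N)"
proof -
  have "real (k i) + 1 \<le> real N" for i
  proof -
    have "k i < N" using assms by (auto simp: cube_index_def)
    then show ?thesis by simp
  qed
  moreover have "t $ i \<le> 1" if "t \<in> cube 1" for t :: "real ^ 'd" and i
    using that by (simp add: mem_box_cart)
  ultimately have "t $ i + real (k i) \<le> real N" if "t \<in> cube 1" for t :: "real ^ 'd" and i
    using that by (metis add.commute add_left_mono order_trans)
  then show ?thesis
    by (auto simp: mem_box_cart corner_def)
qed

lemma cube_mono: "S \<le> T \<Longrightarrow> cube S \<subseteq> cube T"
  by (fastforce simp: mem_box_cart intro: order_trans)

section \<open>A subadditivity lemma\<close>

text \<open>A \<open>d\<close>-dimensional form of Fekete's lemma. From below, \<open>T\<close> is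
  compared with its integer part; from above, with a multiple of a fixed \<open>p\<close> whose
  ratio is close to the infimum.\<close>

lemma subadditive_ratio_tendsto:
  fixes \<gamma> :: "real \<Rightarrow> real"
  assumes nonneg: "\<And>T. 0 \<le> \<gamma> T"
    and mono: "\<And>S T. S \<le> T \<Longrightarrow> \<gamma> S \<le> \<gamma> T"
    and sub: "\<And>T N p. T \<le> real N * real p \<Longrightarrow> N > 0 \<Longrightarrow> p > 0 \<Longrightarrow> \<gamma> T \<le> real N ^ d * \<gamma> (real p)"
  shows "((\<lambda>T. \<gamma> T / T ^ d) \<longlongrightarrow> (INF p\<in>{1::nat..}. \<gamma> (real p) / real p ^ d)) at_top"
    (is "(_ \<longlongrightarrow> ?l) at_top")
proof (rule order_tendstoI)
  have bdd: "bdd_below ((\<lambda>p::nat. \<gamma> (real p) / real p ^ d) ` {1..})"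
    using nonneg by (intro bdd_belowI[of _ 0]) auto
  have l0: "0 \<le> ?l" using nonneg by (intro cINF_greatest) auto
  {
    fix a assume a: "a < ?l"
    have "((\<lambda>T::real. ?l * (1 - 1 / T) ^ d) \<longlongrightarrow> ?l * (1 - 0) ^ d) at_top"
      by (intro tendsto_intros tendsto_divide_0[OF tendsto_const] filterlim_at_top_imp_at_infinity
          filterlim_ident)
    then have "\<forall>\<^sub>F T in at_top. a < ?l * (1 - 1 / T) ^ d"
      by (rule order_tendstoD(1)) (use a in simp)
    moreover have "\<forall>\<^sub>F T::real in at_top. T \<ge> 1" by (rule eventually_ge_at_top)
    ultimately show "\<forall>\<^sub>F T in at_top. a < \<gamma> T / T ^ d"
    proof eventually_elim
      case (elim T)
      \<comment> \<open>Rounding down to an integer costs at most the factor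
        \<open>(1 - 1 / T) ^ d\<close>, which tends to 1.\<close>
      define p where "p = nat \<lfloor>T\<rfloor>"
      have p: "p \<ge> 1" "real p \<le> T" "T - 1 \<le> real p"
        using elim(2) unfolding p_def by linarith+
      have "1 - 1 / T = (T - 1) / T" using elim(2) by (simp add: field_simps)
      then have "?l * (1 - 1 / T) ^ d = ?l * (T - 1) ^ d / T ^ d"
        by (simp only: power_divide times_divide_eq_right)
      also have "\<dots> \<le> ?l * real p ^ d / T ^ d"
        using p elim(2) l0 by (intro divide_right_mono mult_left_mono power_mono) auto
      also have "?l * real p ^ d \<le> \<gamma> (real p)"
        using cINF_lower[OF bdd, of p] p by (simp add: field_simps)
      also have "\<gamma> (real p) \<le> \<gamma> T" using p by (intro mono)
      finally show ?case using elim by (simp add: divide_right_mono)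
    qed
  next
    fix a assume "?l < a"
    then obtain p :: nat where p: "p \<ge> 1" "\<gamma> (real p) / real p ^ d < a"
      using cINF_less_iff[OF _ bdd] by auto
    \<comment> \<open>This is the bound obtained below from \<open>N \<le> T / p + 1\<close> cubes
      of side \<open>p\<close> per direction; its limit is the ratio at \<open>p\<close>, which lies
      below \<open>a\<close>.\<close>
    have "((\<lambda>T::real. (1 / real p + 1 / T) ^ d * \<gamma> (real p)) \<longlongrightarrow>
        (1 / real p + 0) ^ d * \<gamma> (real p)) at_top"
      by (intro tendsto_intros tendsto_divide_0[OF tendsto_const] filterlim_at_top_imp_at_infinity
          filterlim_ident)
    then have "\<forall>\<^sub>F T in at_top. (1 / real p + 1 / T) ^ d * \<gamma> (real p) < a"
      using p(2) by (intro order_tendstoD(2)) (simp_all add: power_divide)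
    moreover have "\<forall>\<^sub>F T::real in at_top. T \<ge> 1" by (rule eventually_ge_at_top)
    ultimately show "\<forall>\<^sub>F T in at_top. \<gamma> T / T ^ d < a"
    proof eventually_elim
      case (elim T)
      define N where "N = nat \<lceil>T / real p\<rceil>"
      have pos: "T / real p > 0" using elim p by simp
      have N: "N > 0" "T / real p \<le> real N" "real N \<le> T / real p + 1"
        using pos unfolding N_def by linarith+
      have "\<gamma> T \<le> real N ^ d * \<gamma> (real p)"
        using N p by (intro sub) (auto simp: field_simps)
      also have "\<dots> \<le> (T / real p + 1) ^ d * \<gamma> (real p)"
        using N nonneg by (intro mult_right_mono power_mono) auto
      finally have "\<gamma> T / T ^ d \<le> (T / real p + 1) ^ d * \<gamma> (real p) / T ^ d"
        using elim by (intro divide_right_mono) auto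
      also have "\<dots> = ((T / real p + 1) / T) ^ d * \<gamma> (real p)"
        by (simp add: power_divide)
      also have "(T / real p + 1) / T = 1 / real p + 1 / T"
        using elim(2) p by (simp add: field_simps)
      finally show ?case using elim by simp
    qed
  }
qed

section \<open>Suprema over shift-invariant grids\<close>

text \<open>What the grids of all meshes in question share: countability makes the suprema
  measurable, the integer points supply the shifts of the cubes, and closure under differences makes
  \<open>L\<close> a group.\<close>

locale invariant_grid =
  fixes m :: "'a measure" and f :: "real ^ 'd \<Rightarrow> 'a \<Rightarrow> real" and L :: "(real ^ 'd) set"
  assumes measurable_f [measurable]: "\<And>t. f t \<in> borel_measurable m"
    and countable_L: "countable L"
    and grid_one_L: "grid 1 \<subseteq> L"
    and L_diff: "\<And>s t. s \<in> L \<Longrightarrow> t \<in> L \<Longrightarrow> s - t \<in> L"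
    and invariant: "sup_shift_invariant m f L"
begin

lemma L_add:
  assumes "s \<in> L" "t \<in> L"
  shows "s + t \<in> L"
proof -
  have "s - ((t - t) - t) \<in> L" by (intro L_diff assms)
  then show ?thesis by simp
qed

lemma sup_integral_finite: "compact K \<Longrightarrow> sup_integral m f (K \<inter> L) < \<infinity>"
  using invariant by (simp add: sup_shift_invariant_def)

text \<open>The hypothesis shifts the functions. Since \<open>L\<close> is a group, shifting by
  \<open>c\<close> maps \<open>L\<close> onto itself, so the shift can be moved to the index
  set.\<close>

lemma sup_integral_translate:
  assumes "compact K" "c \<in> L"
  shows "sup_integral m f ((\<lambda>t. t + c) ` K \<inter> L) = sup_integral m f (K \<inter> L)"
proof -
  have "t + c \<in> L \<longleftrightarrow> t \<in> L" for t
    using assms(2) L_add[of t c] L_diff[of "t + c" c] by auto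
  then have "(\<lambda>t. t + c) ` K \<inter> L = (\<lambda>t. t + c) ` (K \<inter> L)" by blast
  then have "sup_integral m f ((\<lambda>t. t + c) ` K \<inter> L) = sup_integral m (\<lambda>t. f (t + c)) (K \<inter> L)"
    by (simp add: sup_integral_def image_image)
  then show ?thesis using invariant assms by (simp add: sup_shift_invariant_def)
qed

lemma measurable_sup [measurable]:
  "(\<lambda>z. SUP t\<in>K \<inter> L. ennreal \<bar>f t z\<bar>) \<in> borel_measurable m"
  using countable_L by (intro borel_measurable_SUP) (auto intro: countable_subset)

text \<open>Corners are integer points, so every translate contributes the same integral, whether or
  not the cubes overlap.\<close>

lemma sum_translates:
  "(\<integral>\<^sup>+ z. (\<Sum>k\<in>cube_index N. SUP t\<in>(\<lambda>t. t + corner p k) ` cube T \<inter> L. ennreal \<bar>f t z\<bar>) \<partial>m) =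
    of_nat (N ^ CARD('d)) * sup_integral m f (cube T \<inter> L)"
proof -
  have "corner p k \<in> L" for k using grid_one_L corner_in_grid_one by blast
  then have "(\<integral>\<^sup>+ z. (SUP t\<in>(\<lambda>t. t + corner p k) ` cube T \<inter> L. ennreal \<bar>f t z\<bar>) \<partial>m) =
      sup_integral m f (cube T \<inter> L)" for k
    using sup_integral_translate[of "cube T" "corner p k"] by (simp add: sup_integral_def)
  then show ?thesis
    by (simp add: nn_integral_sum card_cube_index)
qed

text \<open>Every point of the box lies in some translate, so the supremum over the box is at most
  the sum of the suprema over the translates.\<close>

lemma sup_integral_cube_le:
  assumes "T \<le> real N * real p" "N > 0" "p > 0"
  shows "sup_integral m f (cube T \<inter> L) \<le> of_nat (N ^ CARD('d)) * sup_integral m f (cube (real p) \<inter> L)"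
proof -
  have "(SUP t\<in>cube T \<inter> L. ennreal \<bar>f t z\<bar>) \<le>
      (\<Sum>k\<in>cube_index N. SUP t\<in>(\<lambda>t. t + corner p k) ` cube (real p) \<inter> L. ennreal \<bar>f t z\<bar>)" for z
  proof (rule SUP_least)
    fix t assume t: "t \<in> cube T \<inter> L"
    then obtain k where k: "k \<in> cube_index N" "t \<in> (\<lambda>t. t + corner p k) ` cube (real p)"
      using cube_subset_translates[OF assms] by blast
    have "ennreal \<bar>f t z\<bar> \<le> (SUP t\<in>(\<lambda>t. t + corner p k) ` cube (real p) \<inter> L. ennreal \<bar>f t z\<bar>)"
      using t k by (intro SUP_upper) auto
    also have "\<dots> \<le> (\<Sum>k\<in>cube_index N.
        SUP t\<in>(\<lambda>t. t + corner p k) ` cube (real p) \<inter> L. ennreal \<bar>f t z\<bar>)"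
      using k finite_cube_index by (intro member_le_sum) auto
    finally show "ennreal \<bar>f t z\<bar> \<le> \<dots>" .
  qed
  then show ?thesis
    unfolding sum_translates[where N = N and p = p and T = "real p", symmetric] sup_integral_def[of m f "cube T \<inter> L"]
    by (intro nn_integral_mono)
qed

text \<open>Nothing is lost in passing to a real number, since the integral is finite; infima and
  subtraction are then available in the reals.\<close>

definition \<gamma> :: "real \<Rightarrow> real" where
  "\<gamma> T = enn2real (sup_integral m f (cube T \<inter> L))"

lemma ennreal_\<gamma>: "ennreal (\<gamma> T) = sup_integral m f (cube T \<inter> L)"
  using sup_integral_finite[of "cube T"] by (simp add: \<gamma>_def compact_cbox less_top)

lemma \<gamma>_nonneg: "0 \<le> \<gamma> T"
  by (simp add: \<gamma>_def)

lemma \<gamma>_mono: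
  assumes "S \<le> T"
  shows "\<gamma> S \<le> \<gamma> T"
proof -
  have "sup_integral m f (cube S \<inter> L) \<le> sup_integral m f (cube T \<inter> L)"
    unfolding sup_integral_def
    using cube_mono[OF assms] by (intro nn_integral_mono SUP_subset_mono) auto
  then show ?thesis by (simp add: ennreal_\<gamma>[symmetric] \<gamma>_nonneg)
qed

lemma \<gamma>_le:
  assumes "T \<le> real N * real p" "N > 0" "p > 0"
  shows "\<gamma> T \<le> real N ^ CARD('d) * \<gamma> (real p)"
proof -
  have "ennreal (\<gamma> T) \<le> ennreal (real N ^ CARD('d) * \<gamma> (real p))"
    using sup_integral_cube_le[OF assms]
    by (simp add: ennreal_\<gamma>[symmetric] ennreal_mult \<gamma>_nonneg ennreal_of_nat_eq_real_of_nat)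
  then show ?thesis by (simp add: \<gamma>_nonneg)
qed

text \<open>The value of the limit constant. Taken as an infimum over integers, it can be compared
  between grids side length by side length, without limits in \<open>T\<close>.\<close>

definition h :: real where
  "h = (INF p\<in>{1::nat..}. \<gamma> (real p) / real p ^ CARD('d))"

lemma h_le:
  assumes "p \<ge> 1"
  shows "h \<le> \<gamma> (real p) / real p ^ CARD('d)"
  unfolding h_def
  by (rule cINF_lower) (use assms \<gamma>_nonneg in \<open>auto intro!: bdd_belowI[of _ 0]\<close>)

lemma h_greatest:
  assumes "\<And>p::nat. p \<ge> 1 \<Longrightarrow> a \<le> \<gamma> (real p) / real p ^ CARD('d)"
  shows "a \<le> h"
  unfolding h_def by (rule cINF_greatest) (use assms in auto)

lemma h_nonneg: "0 \<le> h"
  by (rule h_greatest) (simp add: \<gamma>_nonneg)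

lemma H_ratio_tendsto:
  assumes "L = grid \<delta>"
  shows "(H_ratio m f \<delta> \<longlongrightarrow> ennreal h) at_top"
proof -
  have "((\<lambda>T. ennreal (\<gamma> T / T ^ CARD('d))) \<longlongrightarrow> ennreal h) at_top"
    unfolding h_def
    by (intro tendsto_ennrealI subadditive_ratio_tendsto \<gamma>_nonneg \<gamma>_mono \<gamma>_le)
  \<comment> \<open>For \<open>T > 0\<close> the divisor is positive, so division in
    \<open>ennreal\<close> is real division.\<close>
  moreover have "\<forall>\<^sub>F T in at_top. ennreal (\<gamma> T / T ^ CARD('d)) = H_ratio m f \<delta> T"
    using eventually_gt_at_top[of 0]
    by eventually_elim
      (simp add: H_ratio_def assms[symmetric] ennreal_\<gamma>[symmetric] divide_ennreal \<gamma>_nonneg)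
  ultimately show ?thesis by (rule Lim_transform_eventually)
qed

lemma H_const_eq: "L = grid \<delta> \<Longrightarrow> H_const m f \<delta> = ennreal h"
  unfolding H_const_def by (intro tendsto_Lim H_ratio_tendsto) auto

lemma H_well_defined: "L = grid \<delta> \<Longrightarrow> H_well_defined m f \<delta>"
  unfolding H_well_defined_def using H_ratio_tendsto H_const_eq by simp

end

lemma invariant_grid_grid:
  assumes "\<And>s. integrable m (f s)" "grid 1 \<subseteq> (grid \<delta> :: (real ^ 'd) set)"
    "sup_shift_invariant m f (grid \<delta> :: (real ^ 'd) set)"
  shows "invariant_grid m f (grid \<delta>)"
  by (intro invariant_grid.intro borel_measurable_integrable countable_grid grid_diff assms)

section \<open>Comparison of a coarse grid with a finer one\<close>

locale invariant_grid_pair =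
  coarse: invariant_grid m f L' + fine: invariant_grid m f L
  for m :: "'a measure" and f :: "real ^ 'd \<Rightarrow> 'a \<Rightarrow> real" and L' L +
  assumes sub: "L' \<subseteq> L"
begin

lemma coarse_\<gamma>_le: "coarse.\<gamma> T \<le> fine.\<gamma> T"
proof -
  have "sup_integral m f (cube T \<inter> L') \<le> sup_integral m f (cube T \<inter> L)"
    unfolding sup_integral_def using sub by (intro nn_integral_mono SUP_subset_mono) auto
  then show ?thesis
    by (simp add: coarse.ennreal_\<gamma>[symmetric] fine.ennreal_\<gamma>[symmetric] fine.\<gamma>_nonneg)
qed

lemma coarse_h_le: "coarse.h \<le> fine.h"
proof (rule fine.h_greatest)
  fix p :: nat assume "p \<ge> 1"
  then have "coarse.h \<le> coarse.\<gamma> (real p) / real p ^ CARD('d)" by (rule coarse.h_le)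
  also have "\<dots> \<le> fine.\<gamma> (real p) / real p ^ CARD('d)"
    by (intro divide_right_mono coarse_\<gamma>_le) simp
  finally show "coarse.h \<le> \<dots>" .
qed

text \<open>The fine supremum over the box is at most the largest fine supremum \<open>M j\<close>
  over a unit cube. Trading cube \<open>j\<close> for the box and comparing the other cubes termwise
  gives the bound. Sums stand on both sides to avoid subtraction in \<open>ennreal\<close>.\<close>

lemma sup_exchange:
  fixes g :: "real ^ 'd \<Rightarrow> ennreal"
  assumes "N > 0"
  defines "Q \<equiv> \<lambda>k. (\<lambda>t. t + corner 1 k) ` cube 1"
  shows "(\<Sum>k\<in>cube_index N. SUP t\<in>Q k \<inter> L'. g t) + (SUP t\<in>cube (real N) \<inter> L. g t) \<le>
    (SUP t\<in>cube (real N) \<inter> L'. g t) + (\<Sum>k\<in>cube_index N. SUP t\<in>Q k \<inter> L. g t)"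
proof -
  define M where "M k = (SUP t\<in>Q k \<inter> L. g t)" for k
  define M' where "M' k = (SUP t\<in>Q k \<inter> L'. g t)" for k
  let ?I = "cube_index N :: ('d \<Rightarrow> nat) set"
  have fin: "finite (M ` ?I)" "M ` ?I \<noteq> {}"
    using finite_cube_index cube_index_nonempty[OF assms(1)] by auto
  obtain j where j: "j \<in> ?I" "M j = Max (M ` ?I)"
    using Max_in[OF fin] by auto
  have "(SUP t\<in>cube (real N) \<inter> L. g t) \<le> M j"
  proof (rule SUP_least)
    fix t assume t: "t \<in> cube (real N) \<inter> L"
    then obtain k where k: "k \<in> ?I" "t \<in> Q k"
      using cube_subset_translates[of "real N" N 1] assms by auto
    have "g t \<le> M k" unfolding M_def using t k by (intro SUP_upper) auto
    also have "\<dots> \<le> M j" unfolding j(2) using fin k by (intro Max_ge) auto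
    finally show "g t \<le> M j" .
  qed
  \<comment> \<open>With index \<open>j\<close> split off, \<open>M j\<close> will complete the fine
    sum, while \<open>M' j\<close> remains to be absorbed by the coarse supremum over the
    box.\<close>
  then have "(\<Sum>k\<in>?I. M' k) + (SUP t\<in>cube (real N) \<inter> L. g t) \<le>
      M' j + (\<Sum>k\<in>?I - {j}. M' k) + M j"
    unfolding sum.remove[OF finite_cube_index j(1), of M'] by (rule add_left_mono)
  also have "\<dots> \<le> M' j + (\<Sum>k\<in>?I - {j}. M k) + M j"
    unfolding M_def M'_def using sub
    by (intro add_mono order_refl sum_mono SUP_subset_mono) auto
  also have "\<dots> = M' j + (\<Sum>k\<in>?I. M k)"
    unfolding sum.remove[OF finite_cube_index j(1), of M] by (simp add: add_ac)
  also have "\<dots> \<le> (SUP t\<in>cube (real N) \<inter> L'. g t) + (\<Sum>k\<in>?I. M k)"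
    unfolding M'_def Q_def using translate_subset_cube[OF j(1)]
    by (intro add_mono order_refl SUP_subset_mono) auto
  finally show ?thesis unfolding M_def M'_def .
qed

lemma fine_\<gamma>_le:
  assumes "N > 0"
  shows "real N ^ CARD('d) * coarse.\<gamma> 1 + fine.\<gamma> (real N) \<le>
    coarse.\<gamma> (real N) + real N ^ CARD('d) * fine.\<gamma> 1"
proof -
  let ?Q = "\<lambda>k. (\<lambda>t :: real ^ 'd. t + corner 1 k) ` cube 1"
  have "of_nat (N ^ CARD('d)) * sup_integral m f (cube 1 \<inter> L') + sup_integral m f (cube (real N) \<inter> L)
    = (\<integral>\<^sup>+ z. (\<Sum>k\<in>cube_index N. SUP t\<in>?Q k \<inter> L'. ennreal \<bar>f t z\<bar>) +
        (SUP t\<in>cube (real N) \<inter> L. ennreal \<bar>f t z\<bar>) \<partial>m)"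
    by (simp add: nn_integral_add coarse.sum_translates sup_integral_def)
  also have "\<dots> \<le> (\<integral>\<^sup>+ z. (SUP t\<in>cube (real N) \<inter> L'. ennreal \<bar>f t z\<bar>) +
      (\<Sum>k\<in>cube_index N. SUP t\<in>?Q k \<inter> L. ennreal \<bar>f t z\<bar>) \<partial>m)"
    by (intro nn_integral_mono sup_exchange assms)
  also have "\<dots> = sup_integral m f (cube (real N) \<inter> L') +
      of_nat (N ^ CARD('d)) * sup_integral m f (cube 1 \<inter> L)"
    by (simp add: nn_integral_add fine.sum_translates sup_integral_def)
  finally have "ennreal (real N ^ CARD('d) * coarse.\<gamma> 1 + fine.\<gamma> (real N)) \<le>
      ennreal (coarse.\<gamma> (real N) + real N ^ CARD('d) * fine.\<gamma> 1)"
    by (simp add: coarse.ennreal_\<gamma>[symmetric] fine.ennreal_\<gamma>[symmetric] ennreal_mult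
        coarse.\<gamma>_nonneg fine.\<gamma>_nonneg ennreal_of_nat_eq_real_of_nat)
  then show ?thesis
    by (subst (asm) ennreal_le_iff) (simp_all add: coarse.\<gamma>_nonneg fine.\<gamma>_nonneg)
qed

text \<open>Dividing \<open>fine_\<gamma>_le\<close> by \<open>N ^ CARD('d)\<close> leaves an error
  that does not depend on \<open>N\<close>, namely the gap for a single unit cube.\<close>

lemma fine_h_le: "fine.h - (fine.\<gamma> 1 - coarse.\<gamma> 1) \<le> coarse.h"
proof (rule coarse.h_greatest)
  fix N :: nat assume N: "N \<ge> 1"
  have "fine.h \<le> fine.\<gamma> (real N) / real N ^ CARD('d)" using N by (rule fine.h_le)
  also have "\<dots> \<le> coarse.\<gamma> (real N) / real N ^ CARD('d) + (fine.\<gamma> 1 - coarse.\<gamma> 1)"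
    using fine_\<gamma>_le[of N] N by (simp add: field_simps)
  finally show "fine.h - (fine.\<gamma> 1 - coarse.\<gamma> 1) \<le> coarse.\<gamma> (real N) / real N ^ CARD('d)" by simp
qed

end

section \<open>Meshes tending to zero\<close>

text \<open>Meshes \<open>1 / 2 ^ n\<close> are nested and exhaust \<open>grid 0\<close>, so the
  suprema increase pointwise to the dyadic supremum and monotone convergence applies.\<close>

lemma sup_integral_dyadic_tendsto:
  assumes [measurable]: "\<And>t :: real ^ 'd. f t \<in> borel_measurable m"
  shows "(\<lambda>n. sup_integral m f (K \<inter> grid (1 / 2 ^ n))) \<longlonglongrightarrow> sup_integral m f (K \<inter> grid 0)"
proof -
  let ?s = "\<lambda>n z. SUP t\<in>K \<inter> grid (1 / 2 ^ n). ennreal \<bar>f t z\<bar>"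
  have inc: "incseq ?s"
    by (intro monoI le_funI SUP_subset_mono Int_mono grid_inverse_power2_mono order_refl)
  have meas: "?s n \<in> borel_measurable m" for n
    using countable_grid by (intro borel_measurable_SUP) (auto intro: countable_subset)
  have "(SUP n. ?s n z) = (SUP t\<in>K \<inter> grid 0. ennreal \<bar>f t z\<bar>)" for z
    unfolding grid_zero_eq_Union Int_UN_distrib by (rule SUP_UNION[symmetric])
  then have "sup_integral m f (K \<inter> grid 0) = (SUP n. sup_integral m f (K \<inter> grid (1 / 2 ^ n)))"
    unfolding sup_integral_def
    using nn_integral_monotone_convergence_SUP[OF inc meas] by simp
  moreover have "incseq (\<lambda>n. sup_integral m f (K \<inter> grid (1 / 2 ^ n)))"
    unfolding sup_integral_def
    by (intro monoI nn_integral_mono) (use inc in \<open>auto simp: mono_def le_fun_def\<close>)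
  ultimately show ?thesis by (simp add: LIMSEQ_SUP)
qed

theorem mainTheorem4:
  fixes m :: "'a measure" and f :: "real ^ 'd \<Rightarrow> 'a \<Rightarrow> real"
  assumes "sigma_finite_measure m"
    and "\<And>s. integrable m (f s)"
    and "sup_shift_invariant m f (grid 0)"
  shows "H_well_defined m f 0 \<and>
         (\<forall>n::nat. n \<ge> 1 \<longrightarrow>
            1 / real n \<in> dyadic_rationals \<or> sup_shift_invariant m f (grid (1 / real n)) \<longrightarrow>
            H_well_defined m f (1 / real n)) \<and>
         (\<lambda>n::nat. H_const m f (1 / 2 ^ n)) \<longlonglongrightarrow> H_const m f 0"
proof (intro conjI allI impI)
  interpret fine: invariant_grid m f "grid 0"
    using assms grid_one_subset_dyadic by (intro invariant_grid_grid)
  show "H_well_defined m f 0" by (rule fine.H_well_defined) simp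

  have mesh: "invariant_grid m f (grid (1 / real n))"
    if "n \<ge> 1" "1 / real n \<in> dyadic_rationals \<or> sup_shift_invariant m f (grid (1 / real n))" for n
  proof (rule invariant_grid_grid[OF assms(2)])
    show "grid 1 \<subseteq> (grid (1 / real n) :: (real ^ 'd) set)" using that(1) by (rule grid_one_subset)
    show "sup_shift_invariant m f (grid (1 / real n))"
      \<comment> \<open>A dyadic mesh inherits the condition from \<open>grid 0\<close>; for any
        other mesh it is the second disjunct.\<close>
      using that sup_shift_invariant_subset[OF assms(3) closed_grid grid_subset_dyadic] by auto
  qed
  then show "H_well_defined m f (1 / real n)"
    if "n \<ge> 1" "1 / real n \<in> dyadic_rationals \<or> sup_shift_invariant m f (grid (1 / real n))" for n
    using that invariant_grid.H_well_defined by blast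

  define h where "h n = invariant_grid.h m f (grid (1 / 2 ^ n))" for n :: nat
  define \<gamma> where "\<gamma> n = invariant_grid.\<gamma> m f (grid (1 / 2 ^ n)) 1" for n :: nat
  have coarse: "invariant_grid m f (grid (1 / 2 ^ n))" for n
    using mesh[of "2 ^ n"] inverse_power2_dyadic by simp
  have pair: "invariant_grid_pair m f (grid (1 / 2 ^ n)) (grid 0)" for n
    by (intro invariant_grid_pair.intro coarse fine.invariant_grid_axioms
        invariant_grid_pair_axioms.intro grid_subset_dyadic inverse_power2_dyadic)
  have "(\<lambda>n. enn2real (sup_integral m f (cube 1 \<inter> grid (1 / 2 ^ n))))
      \<longlonglongrightarrow> enn2real (sup_integral m f (cube 1 \<inter> grid 0))"
  \<comment> \<open>The rule needs the limit in the form \<open>ennreal x\<close>; finiteness of the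
    integral over the unit cube provides it.\<close>
  proof (rule tendsto_enn2real)
    show "(\<lambda>n. sup_integral m f (cube 1 \<inter> grid (1 / 2 ^ n)))
        \<longlonglongrightarrow> ennreal (enn2real (sup_integral m f (cube 1 \<inter> grid 0)))"
      using sup_integral_dyadic_tendsto[OF fine.measurable_f, where K = "cube 1"]
      by (simp add: fine.ennreal_\<gamma>[unfolded fine.\<gamma>_def])
  qed simp
  then have "\<gamma> \<longlonglongrightarrow> fine.\<gamma> 1"
    by (simp add: \<gamma>_def[abs_def] fine.\<gamma>_def invariant_grid.\<gamma>_def[OF coarse])
  then have "(\<lambda>n. fine.h - (fine.\<gamma> 1 - \<gamma> n)) \<longlonglongrightarrow> fine.h - (fine.\<gamma> 1 - fine.\<gamma> 1)"
    by (intro tendsto_intros)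
  \<comment> \<open>\<open>h n\<close> lies between \<open>fine.h\<close> minus the unit-cube gap
    and \<open>fine.h\<close>, and the gap tends to 0.\<close>
  then have "h \<longlonglongrightarrow> fine.h"
    by (intro tendsto_sandwich[of "\<lambda>n. fine.h - (fine.\<gamma> 1 - \<gamma> n)" h sequentially "\<lambda>_. fine.h"])
      (auto simp: h_def \<gamma>_def invariant_grid_pair.fine_h_le[OF pair]
        invariant_grid_pair.coarse_h_le[OF pair])
  then show "(\<lambda>n::nat. H_const m f (1 / 2 ^ n)) \<longlonglongrightarrow> H_const m f 0"
    unfolding fine.H_const_eq[OF refl] invariant_grid.H_const_eq[OF coarse refl] h_def
    by (rule tendsto_ennrealI)
qed

end
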